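(* Let $\mathcal{X}$ be a finite set, let $\mu$ be a probability distribution on $\mathcal{X}$ with $\mu(x)>0$ for all $x\in\mathcal{X}$, and let $Q$ be the generator of an irreducible continuous-time Markov chain on $\mathcal{X}$. Let $M_1=M_1(Q,\mu)$ and $M_2=M_2(Q,\mu)$ be the two Metropolis-Hastings generators. Then for every $\alpha\in[0,1]$ the convex combination $\alpha M_1+(1-\alpha)M_2$ minimizes the distance $d_\mu$ between $Q$ and $\mathcal{R}(\mu)$, that is, $$d_{\mu}(Q,\mathcal{R}(\mu))= d_{\mu}(Q,\alpha M_1 + (1-\alpha)M_2).$$ Moreover, $M_1$ is the unique closest element to $Q$ (with respect to $d_\mu$) among those $N\in\mathcal{R}(\mu)$ satisfying $N(x,y)\leq Q(x,y)$ for all $x\neq y$, and $M_2$ is the unique closest element to $Q$ (with respect to $d_\mu$) among those $N\in\mathcal{R}(\mu)$ satisfying $N(x,y)\geq Q(x,y)$ for all $x\neq y$.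
   Context: A (conservative) Markov generator on $\mathcal{X}$ is a real matrix $Q=(Q(x,y))_{x,y\in\mathcal{X}}$ with $Q(x,y)\geq 0$ for $x\neq y$ and every row summing to $0$; $\mathcal{S}(\mathcal{X})$ denotes the set of all such matrices. A generator $N$ is $\mu$-reversible if $\mu(x)N(x,y)=\mu(y)N(y,x)$ for all $x,y$; $\mathcal{R}(\mu)\subseteq\mathcal{S}(\mathcal{X})$ denotes the set of $\mu$-reversible Markov generators (not required to be irreducible). Metropolis-Hastings generators: for $x\neq y$, $$M_1(x,y)=\min\Big\{Q(x,y),\tfrac{\mu(y)}{\mu(x)}Q(y,x)\Big\},\qquad M_2(x,y)=\max\Big\{Q(x,y),\tfrac{\mu(y)}{\mu(x)}Q(y,x)\Big\},$$ and $M_i(x,x)=-\sum_{z\neq x}M_i(x,z)$ for $i=1,2$. Metric on $\mathcal{S}(\mathcal{X})$: $d_{\mu}(Q_1,Q_2)=\sum_{x\in\mathcal{X}}\sum_{y:\,y\neq x}\mu(x)|Q_1(x,y)-Q_2(x,y)|$, and $d_{\mu}(Q,\mathcal{R}(\mu))=\inf_{M\in\mathcal{R}(\mu)}d_{\mu}(Q,M)$. *)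

theory Defs
  imports "HOL-Probability.Probability"
begin

text \<open>
  The state space is a finite type \<open>'x\<close>; a real matrix indexed by it has type
  \<open>real^'x^'x\<close>, with entry \<open>Q $ x $ y\<close> the rate from \<open>x\<close> to \<open>y\<close>.
\<close>

definition generators :: "(real^'x^'x::finite) set" where
  "generators = {Q. (\<forall>x y. x \<noteq> y \<longrightarrow> Q $ x $ y \<ge> 0) \<and> (\<forall>x. (\<Sum>y\<in>UNIV. Q $ x $ y) = 0)}"

text \<open>
  Irreducibility of the continuous-time chain with generator \<open>Q\<close>: every state is reachable
  from every other one through jumps of positive rate. A one-point chain is irreducible.
\<close>

definition irreducible_generator :: "real^'x^'x::finite \<Rightarrow> bool" where
  "irreducible_generator Q \<longleftrightarrow> (\<forall>x y. (x, y) \<in> {(u, v). u \<noteq> v \<and> Q $ u $ v > 0}\<^sup>*)"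

definition reversible_generators :: "'x::finite pmf \<Rightarrow> (real^'x^'x) set" where
  "reversible_generators \<mu> =
     {N \<in> generators. \<forall>x y. pmf \<mu> x * N $ x $ y = pmf \<mu> y * N $ y $ x}"

definition from_rates :: "('x::finite \<Rightarrow> 'x \<Rightarrow> real) \<Rightarrow> real^'x^'x" where
  "from_rates r = (\<chi> x y. if x = y then - (\<Sum>z\<in>UNIV - {x}. r x z) else r x y)"

definition MH1 :: "real^'x^'x::finite \<Rightarrow> 'x pmf \<Rightarrow> real^'x^'x" where
  "MH1 Q \<mu> = from_rates (\<lambda>x y. min (Q $ x $ y) (pmf \<mu> y / pmf \<mu> x * Q $ y $ x))"

definition MH2 :: "real^'x^'x::finite \<Rightarrow> 'x pmf \<Rightarrow> real^'x^'x" where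
  "MH2 Q \<mu> = from_rates (\<lambda>x y. max (Q $ x $ y) (pmf \<mu> y / pmf \<mu> x * Q $ y $ x))"

definition gen_dist :: "'x::finite pmf \<Rightarrow> real^'x^'x \<Rightarrow> real^'x^'x \<Rightarrow> real" where
  "gen_dist \<mu> Q1 Q2 =
     (\<Sum>x\<in>UNIV. \<Sum>y\<in>UNIV - {x}. pmf \<mu> x * \<bar>Q1 $ x $ y - Q2 $ x $ y\<bar>)"

definition gen_setdist :: "'x::finite pmf \<Rightarrow> real^'x^'x \<Rightarrow> (real^'x^'x) set \<Rightarrow> real" where
  "gen_setdist \<mu> Q A = (INF M\<in>A. gen_dist \<mu> Q M)"

end

theory Submission
  imports Defs
begin

text \<open>
  Everything is read off the probability flow \<open>a x y = \<mu>(x) Q(x,y)\<close>. A generator \<open>N\<close> is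
  reversible exactly when its flow \<open>n x y = \<mu>(x) N(x,y)\<close> is symmetric, and \<open>gen_dist\<close> is the
  \<open>\<ell>\<^sup>1\<close> distance between off-diagonal flows. The flows of the two Metropolis-Hastings
  generators are \<open>min (a x y) (a y x)\<close> and \<open>max (a x y) (a y x)\<close>.

  For symmetric \<open>n\<close>, pairing the terms of \<open>(x, y)\<close> and \<open>(y, x)\<close> turns twice the distance into the
  sum of \<open>\<bar>a x y - n x y\<bar> + \<bar>a y x - n x y\<bar>\<close> (\<open>gen_dist_paired\<close>): each unordered pair asks for one
  real number close to two given ones. That cost is at least \<open>\<bar>a x y - a y x\<bar>\<close>, and any
  number between the two attains it. This is why every convex combination of the minimum and the
  maximum is optimal, and why the minimiser is not unique in general.

  A one-sided constraint removes the ambiguity. A symmetric flow lying below \<open>a\<close> lies below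
  \<open>a x y\<close> and \<open>a y x\<close>, hence below their minimum. So the first Metropolis-Hastings generator
  sits entrywise between \<open>Q\<close> and every competitor \<open>N\<close>, the triangle inequality
  becomes an equality (\<open>gen_dist_between\<close>), and the excess distance of \<open>N\<close> is its distance to that
  generator, which is positive unless \<open>N\<close> equals it (\<open>is_arg_min_gen_dist_iff\<close>). The case of the maximum is the mirror image.
\<close>

lemma sum_offdiag_swap:
  fixes f :: "'x::finite \<Rightarrow> 'x \<Rightarrow> 'a::comm_monoid_add"
  shows "(\<Sum>x\<in>UNIV. \<Sum>y\<in>UNIV - {x}. f x y) = (\<Sum>x\<in>UNIV. \<Sum>y\<in>UNIV - {x}. f y x)"
proof -
  have *: "UNIV - {x} = {y\<in>UNIV. x \<noteq> y}" "UNIV - {x} = {y\<in>UNIV. y \<noteq> x}" for x :: 'x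
    by auto
  have "(\<Sum>x\<in>UNIV. \<Sum>y\<in>UNIV - {x}. f x y) = (\<Sum>y\<in>UNIV. \<Sum>x\<in>{x\<in>UNIV. x \<noteq> y}. f x y)"
    unfolding *(1) by (rule sum.swap_restrict) simp_all
  then show ?thesis
    by (simp add: *(2))
qed

lemma reversible_generatorsI:
  assumes "N \<in> generators"
    and "\<And>x y. x \<noteq> y \<Longrightarrow> pmf \<mu> x * N $ x $ y = pmf \<mu> y * N $ y $ x"
  shows "N \<in> reversible_generators \<mu>"
  using assms unfolding reversible_generators_def by force

lemma convex_reversible_generators: "convex (reversible_generators \<mu>)"
proof (rule convexI)
  fix A B and u v :: real
  assume A: "A \<in> reversible_generators \<mu>" and B: "B \<in> reversible_generators \<mu>"
    and uv: "0 \<le> u" "0 \<le> v"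
  have "u *\<^sub>R A + v *\<^sub>R B \<in> generators"
    using A B uv unfolding reversible_generators_def generators_def
    by (auto simp: sum.distrib sum_distrib_left[symmetric])
  moreover have "pmf \<mu> x * (u * A $ x $ y + v * B $ x $ y)
      = pmf \<mu> y * (u * A $ y $ x + v * B $ y $ x)" for x y
  proof -
    have "pmf \<mu> x * A $ x $ y = pmf \<mu> y * A $ y $ x" "pmf \<mu> x * B $ x $ y = pmf \<mu> y * B $ y $ x"
      using A B unfolding reversible_generators_def by auto
    then show ?thesis
      by (simp add: distrib_left mult.left_commute)
  qed
  ultimately show "u *\<^sub>R A + v *\<^sub>R B \<in> reversible_generators \<mu>"
    by (intro reversible_generatorsI) auto
qed

lemma from_rates_in_generators:
  assumes "\<And>x y. x \<noteq> y \<Longrightarrow> 0 \<le> r x y"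
  shows "from_rates r \<in> generators"
proof -
  have "(\<Sum>y\<in>UNIV. from_rates r $ x $ y) = 0" for x
  proof -
    have "(\<Sum>y\<in>UNIV. from_rates r $ x $ y)
        = from_rates r $ x $ x + (\<Sum>y\<in>UNIV - {x}. from_rates r $ x $ y)"
      by (intro sum.remove) auto
    also have "(\<Sum>y\<in>UNIV - {x}. from_rates r $ x $ y) = (\<Sum>y\<in>UNIV - {x}. r x y)"
      by (intro sum.cong) (auto simp: from_rates_def)
    finally show ?thesis
      by (simp add: from_rates_def)
  qed
  then show ?thesis
    using assms by (auto simp: generators_def from_rates_def)
qed

lemma generators_eqI:
  assumes "A \<in> generators" "B \<in> generators"
    and off: "\<And>x y. x \<noteq> y \<Longrightarrow> A $ x $ y = B $ x $ y"
  shows "A = B"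
proof -
  have diag: "C $ x $ x = - (\<Sum>y\<in>UNIV - {x}. C $ x $ y)" if "C \<in> generators" for C and x :: 'a
    using that by (simp add: generators_def sum.remove[of UNIV x] eq_neg_iff_add_eq_0)
  have "A $ x $ y = B $ x $ y" for x y
  proof (cases "x = y")
    case True
    have "(\<Sum>z\<in>UNIV - {x}. A $ x $ z) = (\<Sum>z\<in>UNIV - {x}. B $ x $ z)"
      by (intro sum.cong) (auto intro: off)
    then show ?thesis
      using True assms(1,2) by (simp add: diag)
  qed (rule off)
  then show ?thesis
    by (simp add: vec_eq_iff)
qed

text \<open>
  Multiplying by \<open>\<mu>(x)\<close> clears the fraction in the acceptance ratio and leaves a
  flow symmetric in \<open>x\<close> and \<open>y\<close>, which is detailed balance.
\<close>

lemma
  assumes "pmf \<mu> x > 0" "x \<noteq> y"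
  shows MH1_flow: "pmf \<mu> x * MH1 Q \<mu> $ x $ y = min (pmf \<mu> x * Q $ x $ y) (pmf \<mu> y * Q $ y $ x)"
    and MH2_flow: "pmf \<mu> x * MH2 Q \<mu> $ x $ y = max (pmf \<mu> x * Q $ x $ y) (pmf \<mu> y * Q $ y $ x)"
  using assms
  by (simp_all add: MH1_def MH2_def from_rates_def min_mult_distrib_left max_mult_distrib_left)

lemma
  assumes "\<And>x. pmf \<mu> x > 0" "Q \<in> generators"
  shows MH1_reversible: "MH1 Q \<mu> \<in> reversible_generators \<mu>"
    and MH2_reversible: "MH2 Q \<mu> \<in> reversible_generators \<mu>"
proof -
  have "MH1 Q \<mu> \<in> generators" "MH2 Q \<mu> \<in> generators"
    unfolding MH1_def MH2_def using assms(2)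
    by (intro from_rates_in_generators; simp add: generators_def le_max_iff_disj)+
  then show "MH1 Q \<mu> \<in> reversible_generators \<mu>" "MH2 Q \<mu> \<in> reversible_generators \<mu>"
    by (auto intro!: reversible_generatorsI
        simp: MH1_flow MH2_flow assms(1) min.commute max.commute)
qed

lemma gen_dist_flow:
  "gen_dist \<mu> A B = (\<Sum>x\<in>UNIV. \<Sum>y\<in>UNIV - {x}. \<bar>pmf \<mu> x * A $ x $ y - pmf \<mu> x * B $ x $ y\<bar>)"
  by (simp add: gen_dist_def abs_mult right_diff_distrib[symmetric])

lemma gen_dist_nonneg: "0 \<le> gen_dist \<mu> A B"
  unfolding gen_dist_def by (intro sum_nonneg) auto

text \<open>
  The distance ignores the diagonal; it separates generators because their diagonal is
  determined by the other entries, and it needs every weight to be positive.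
\<close>

lemma gen_dist_eq_0_iff:
  assumes "\<And>x. pmf \<mu> x > 0" "A \<in> generators" "B \<in> generators"
  shows "gen_dist \<mu> A B = 0 \<longleftrightarrow> A = B"
proof
  assume "gen_dist \<mu> A B = 0"
  then have "\<forall>x. \<forall>y\<in>UNIV - {x}. pmf \<mu> x = 0 \<or> A $ x $ y = B $ x $ y"
    unfolding gen_dist_def by (simp add: sum_nonneg sum_nonneg_eq_0_iff)
  then have "A $ x $ y = B $ x $ y" if "x \<noteq> y" for x y
    using assms(1)[of x] that by force
  then show "A = B"
    using assms(2,3) by (intro generators_eqI)
qed (simp add: gen_dist_def)

text \<open>
  The triangle inequality is an equality at an entrywise intermediate matrix. The segments are
  unordered, which serves approximation of \<open>Q\<close> from below and from above alike.
\<close>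

lemma gen_dist_between:
  assumes "\<And>x y. x \<noteq> y \<Longrightarrow> B $ x $ y \<in> closed_segment (A $ x $ y) (C $ x $ y)"
  shows "gen_dist \<mu> A C = gen_dist \<mu> A B + gen_dist \<mu> B C"
proof -
  have "\<bar>A $ x $ y - C $ x $ y\<bar> = \<bar>A $ x $ y - B $ x $ y\<bar> + \<bar>B $ x $ y - C $ x $ y\<bar>"
    if "x \<noteq> y" for x y
    using assms[OF that] by (auto simp: closed_segment_eq_real_ivl split: if_splits)
  then show ?thesis
    unfolding gen_dist_def sum.distrib[symmetric] distrib_left[symmetric]
    by (intro sum.cong) auto
qed

text \<open>
  Detailed balance for \<open>N\<close> lets the term of \<open>(y, x)\<close> be compared with the same number
  \<open>\<mu>(x) N(x,y)\<close> as the term of \<open>(x, y)\<close>.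
\<close>

lemma gen_dist_paired:
  assumes "N \<in> reversible_generators \<mu>"
  shows "2 * gen_dist \<mu> Q N = (\<Sum>x\<in>UNIV. \<Sum>y\<in>UNIV - {x}.
      \<bar>pmf \<mu> x * Q $ x $ y - pmf \<mu> x * N $ x $ y\<bar> + \<bar>pmf \<mu> y * Q $ y $ x - pmf \<mu> x * N $ x $ y\<bar>)"
proof -
  have "gen_dist \<mu> Q N = (\<Sum>x\<in>UNIV. \<Sum>y\<in>UNIV - {x}. \<bar>pmf \<mu> y * Q $ y $ x - pmf \<mu> y * N $ y $ x\<bar>)"
    unfolding gen_dist_flow by (rule sum_offdiag_swap)
  also have "\<dots> = (\<Sum>x\<in>UNIV. \<Sum>y\<in>UNIV - {x}. \<bar>pmf \<mu> y * Q $ y $ x - pmf \<mu> x * N $ x $ y\<bar>)"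
  proof -
    have "pmf \<mu> y * N $ y $ x = pmf \<mu> x * N $ x $ y" for x y
      using assms by (simp add: reversible_generators_def)
    then show ?thesis
      by simp
  qed
  finally show ?thesis
    by (simp add: sum.distrib flip: gen_dist_flow)
qed

text \<open>The lower bound is the net flow of \<open>Q\<close>, which measures how far \<open>Q\<close> is from detailed balance.\<close>

lemma gen_dist_reversible_lower_bound:
  assumes "N \<in> reversible_generators \<mu>"
  shows "(\<Sum>x\<in>UNIV. \<Sum>y\<in>UNIV - {x}. \<bar>pmf \<mu> x * Q $ x $ y - pmf \<mu> y * Q $ y $ x\<bar>)
    \<le> 2 * gen_dist \<mu> Q N"
  unfolding gen_dist_paired[OF assms] by (intro sum_mono) linarith

lemma gen_dist_reversible_between:
  assumes "N \<in> reversible_generators \<mu>"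
    and "\<And>x y. x \<noteq> y \<Longrightarrow>
      pmf \<mu> x * N $ x $ y \<in> closed_segment (pmf \<mu> x * Q $ x $ y) (pmf \<mu> y * Q $ y $ x)"
  shows "2 * gen_dist \<mu> Q N
    = (\<Sum>x\<in>UNIV. \<Sum>y\<in>UNIV - {x}. \<bar>pmf \<mu> x * Q $ x $ y - pmf \<mu> y * Q $ y $ x\<bar>)"
proof -
  have "\<bar>pmf \<mu> x * Q $ x $ y - pmf \<mu> x * N $ x $ y\<bar> + \<bar>pmf \<mu> y * Q $ y $ x - pmf \<mu> x * N $ x $ y\<bar>
      = \<bar>pmf \<mu> x * Q $ x $ y - pmf \<mu> y * Q $ y $ x\<bar>" if "x \<noteq> y" for x y
    using assms(2)[OF that] by (auto simp: closed_segment_eq_real_ivl split: if_splits)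
  then show ?thesis
    unfolding gen_dist_paired[OF assms(1)] by (intro sum.cong) auto
qed

lemma MH_convex_combination_flow:
  assumes "pmf \<mu> x > 0" "x \<noteq> y" "\<alpha> \<in> {0..1}"
  shows "pmf \<mu> x * (\<alpha> *\<^sub>R MH1 Q \<mu> + (1 - \<alpha>) *\<^sub>R MH2 Q \<mu>) $ x $ y
    \<in> closed_segment (pmf \<mu> x * Q $ x $ y) (pmf \<mu> y * Q $ y $ x)"
proof -
  let ?a = "pmf \<mu> x * Q $ x $ y" and ?b = "pmf \<mu> y * Q $ y $ x"
  have "pmf \<mu> x * (\<alpha> *\<^sub>R MH1 Q \<mu> + (1 - \<alpha>) *\<^sub>R MH2 Q \<mu>) $ x $ y
      = \<alpha> *\<^sub>R (pmf \<mu> x * MH1 Q \<mu> $ x $ y) + (1 - \<alpha>) *\<^sub>R (pmf \<mu> x * MH2 Q \<mu> $ x $ y)"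
    by (simp add: algebra_simps)
  also have "\<dots> = \<alpha> *\<^sub>R min ?a ?b + (1 - \<alpha>) *\<^sub>R max ?a ?b"
    using assms by (simp add: MH1_flow MH2_flow)
  also have "\<dots> \<in> closed_segment ?a ?b"
    using assms(3) by (intro convexD[OF convex_closed_segment]) (auto simp: min_def max_def)
  finally show ?thesis .
qed

text \<open>
  The inequalities against \<open>Q\<close> at \<open>(x, y)\<close> and at \<open>(y, x)\<close> bound the same flow of \<open>N\<close>.
\<close>

lemma
  assumes "\<And>x. pmf \<mu> x > 0" "N \<in> reversible_generators \<mu>" "x \<noteq> y"
  shows reversible_le_MH1: "(\<And>x y. x \<noteq> y \<Longrightarrow> N $ x $ y \<le> Q $ x $ y) \<Longrightarrow> N $ x $ y \<le> MH1 Q \<mu> $ x $ y"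
    and MH2_le_reversible: "(\<And>x y. x \<noteq> y \<Longrightarrow> Q $ x $ y \<le> N $ x $ y) \<Longrightarrow> MH2 Q \<mu> $ x $ y \<le> N $ x $ y"
proof -
  have rev: "pmf \<mu> x * N $ x $ y = pmf \<mu> y * N $ y $ x"
    using assms(2) by (simp add: reversible_generators_def)
  show "N $ x $ y \<le> MH1 Q \<mu> $ x $ y" if "\<And>x y. x \<noteq> y \<Longrightarrow> N $ x $ y \<le> Q $ x $ y"
  proof -
    have "pmf \<mu> y * N $ y $ x \<le> pmf \<mu> y * Q $ y $ x" "pmf \<mu> x * N $ x $ y \<le> pmf \<mu> x * Q $ x $ y"
      using that assms(3) by (auto intro!: mult_left_mono)
    then have "pmf \<mu> x * N $ x $ y \<le> pmf \<mu> x * MH1 Q \<mu> $ x $ y"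
      using assms(1,3) rev by (simp add: MH1_flow)
    then show ?thesis
      using assms(1) by simp
  qed
  show "MH2 Q \<mu> $ x $ y \<le> N $ x $ y" if "\<And>x y. x \<noteq> y \<Longrightarrow> Q $ x $ y \<le> N $ x $ y"
  proof -
    have "pmf \<mu> y * Q $ y $ x \<le> pmf \<mu> y * N $ y $ x" "pmf \<mu> x * Q $ x $ y \<le> pmf \<mu> x * N $ x $ y"
      using that assms(3) by (auto intro!: mult_left_mono)
    then have "pmf \<mu> x * MH2 Q \<mu> $ x $ y \<le> pmf \<mu> x * N $ x $ y"
      using assms(1,3) rev by (simp add: MH2_flow)
    then show ?thesis
      using assms(1) by simp
  qed
qed

lemma MH1_le: "x \<noteq> y \<Longrightarrow> MH1 Q \<mu> $ x $ y \<le> Q $ x $ y"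
  and MH2_ge: "x \<noteq> y \<Longrightarrow> Q $ x $ y \<le> MH2 Q \<mu> $ x $ y"
  by (simp_all add: MH1_def MH2_def from_rates_def)

text \<open>
  If \<open>M\<close> lies on a geodesic from \<open>Q\<close> to every admissible \<open>N\<close>, then \<open>N\<close> costs exactly
  \<open>gen_dist \<mu> M N\<close> more than \<open>M\<close>, so \<open>M\<close> is the only minimiser.
\<close>

lemma is_arg_min_gen_dist_iff:
  assumes "\<And>x. pmf \<mu> x > 0" "P M" "\<And>N. P N \<Longrightarrow> N \<in> generators"
    and add: "\<And>N. P N \<Longrightarrow> gen_dist \<mu> Q N = gen_dist \<mu> Q M + gen_dist \<mu> M N"
  shows "is_arg_min (gen_dist \<mu> Q) P N \<longleftrightarrow> N = M"
proof
  assume N: "is_arg_min (gen_dist \<mu> Q) P N"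
  then have "P N" "gen_dist \<mu> Q N \<le> gen_dist \<mu> Q M"
    using assms(2) by (auto simp: is_arg_min_linorder)
  then have "gen_dist \<mu> M N = 0"
    using add[of N] gen_dist_nonneg[of \<mu> M N] by linarith
  then show "N = M"
    using gen_dist_eq_0_iff[of \<mu> M N] assms(1-3) \<open>P N\<close> by simp
next
  assume "N = M"
  then show "is_arg_min (gen_dist \<mu> Q) P N"
    using assms(2) gen_dist_nonneg[of \<mu> M] by (auto simp: is_arg_min_linorder dest: add)
qed

theorem theorem3p1:
  fixes \<mu> :: "'x::finite pmf" and Q :: "real^'x^'x"
  assumes "\<And>x. pmf \<mu> x > 0"
    and "Q \<in> generators"
    and "irreducible_generator Q"
  shows "(\<forall>\<alpha>\<in>{0..1::real}.
            \<alpha> *\<^sub>R MH1 Q \<mu> + (1 - \<alpha>) *\<^sub>R MH2 Q \<mu> \<in> reversible_generators \<mu> \<and>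
            gen_setdist \<mu> Q (reversible_generators \<mu>)
              = gen_dist \<mu> Q (\<alpha> *\<^sub>R MH1 Q \<mu> + (1 - \<alpha>) *\<^sub>R MH2 Q \<mu>)) \<and>
         (\<forall>N. is_arg_min (gen_dist \<mu> Q)
                 (\<lambda>N. N \<in> reversible_generators \<mu> \<and> (\<forall>x y. x \<noteq> y \<longrightarrow> N $ x $ y \<le> Q $ x $ y)) N
               \<longleftrightarrow> N = MH1 Q \<mu>) \<and>
         (\<forall>N. is_arg_min (gen_dist \<mu> Q)
                 (\<lambda>N. N \<in> reversible_generators \<mu> \<and> (\<forall>x y. x \<noteq> y \<longrightarrow> N $ x $ y \<ge> Q $ x $ y)) N
               \<longleftrightarrow> N = MH2 Q \<mu>)"
proof (intro conjI ballI allI)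
  fix \<alpha> :: real
  assume \<alpha>: "\<alpha> \<in> {0..1}"
  let ?M = "\<alpha> *\<^sub>R MH1 Q \<mu> + (1 - \<alpha>) *\<^sub>R MH2 Q \<mu>"
  show rev: "?M \<in> reversible_generators \<mu>"
    using \<alpha> MH1_reversible[OF assms(1,2)] MH2_reversible[OF assms(1,2)]
    by (intro convexD[OF convex_reversible_generators]) auto
  have "2 * gen_dist \<mu> Q ?M
      = (\<Sum>x\<in>UNIV. \<Sum>y\<in>UNIV - {x}. \<bar>pmf \<mu> x * Q $ x $ y - pmf \<mu> y * Q $ y $ x\<bar>)"
    using rev MH_convex_combination_flow[OF assms(1) _ \<alpha>] by (rule gen_dist_reversible_between)
  then have "gen_dist \<mu> Q ?M \<le> gen_dist \<mu> Q N" if "N \<in> reversible_generators \<mu>" for N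
    using gen_dist_reversible_lower_bound[OF that, of Q] by linarith
  then show "gen_setdist \<mu> Q (reversible_generators \<mu>) = gen_dist \<mu> Q ?M"
    unfolding gen_setdist_def using rev by (intro cInf_eq_minimum) auto
next
  fix N
  let ?P = "\<lambda>N. N \<in> reversible_generators \<mu> \<and> (\<forall>x y. x \<noteq> y \<longrightarrow> N $ x $ y \<le> Q $ x $ y)"
  show "is_arg_min (gen_dist \<mu> Q) ?P N \<longleftrightarrow> N = MH1 Q \<mu>"
  proof (rule is_arg_min_gen_dist_iff[OF assms(1)])
    show "?P (MH1 Q \<mu>)"
      using MH1_reversible[OF assms(1,2)] MH1_le by blast
    show "N \<in> generators" if "?P N" for N
      using that by (simp add: reversible_generators_def)
    show "gen_dist \<mu> Q N = gen_dist \<mu> Q (MH1 Q \<mu>) + gen_dist \<mu> (MH1 Q \<mu>) N" if "?P N" for N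
    proof (rule gen_dist_between)
      fix x y :: 'x
      assume "x \<noteq> y"
      then show "MH1 Q \<mu> $ x $ y \<in> closed_segment (Q $ x $ y) (N $ x $ y)"
        using MH1_le[of x y Q \<mu>] reversible_le_MH1[OF assms(1), of N x y Q] that
        by (simp add: closed_segment_eq_real_ivl)
    qed
  qed
next
  fix N
  let ?P = "\<lambda>N. N \<in> reversible_generators \<mu> \<and> (\<forall>x y. x \<noteq> y \<longrightarrow> N $ x $ y \<ge> Q $ x $ y)"
  show "is_arg_min (gen_dist \<mu> Q) ?P N \<longleftrightarrow> N = MH2 Q \<mu>"
  proof (rule is_arg_min_gen_dist_iff[OF assms(1)])
    show "?P (MH2 Q \<mu>)"
      using MH2_reversible[OF assms(1,2)] MH2_ge by blast
    show "N \<in> generators" if "?P N" for N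
      using that by (simp add: reversible_generators_def)
    show "gen_dist \<mu> Q N = gen_dist \<mu> Q (MH2 Q \<mu>) + gen_dist \<mu> (MH2 Q \<mu>) N" if "?P N" for N
    proof (rule gen_dist_between)
      fix x y :: 'x
      assume "x \<noteq> y"
      then show "MH2 Q \<mu> $ x $ y \<in> closed_segment (Q $ x $ y) (N $ x $ y)"
        using MH2_ge[of x y Q \<mu>] MH2_le_reversible[OF assms(1), of N x y Q] that
        by (simp add: closed_segment_eq_real_ivl)
    qed
  qed
qed

end
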